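(* For $n\ge 1$ let $a_n = |S_n^2(132,231)|$. Then $a_1=1$ and $a_{n+1} = 2a_n + 2^{n}$ for all $n \ge 1$.
   Context: A $3$-permutation of size $n$ is an ordered pair $(\sigma,\sigma')$ of permutations of $[n]=\{1,\dots,n\}$. A (classical) permutation $\tau\in S_n$ contains a pattern $\pi\in S_k$ if there are indices $c_1<\dots<c_k$ such that $\tau(c_1)\cdots\tau(c_k)$ is order-isomorphic to $\pi$, and avoids $\pi$ otherwise. A $3$-permutation $(\sigma,\sigma')$ avoids a pattern $\pi\in S_k$ if each of the three permutations $\sigma$, $\sigma'$, and $\sigma'\circ\sigma^{-1}$ (where $(\sigma'\circ\sigma^{-1})(i)=\sigma'(\sigma^{-1}(i))$) avoids $\pi$. $S_n^2(\pi_1,\dots,\pi_m)$ denotes the set of $3$-permutations of size $n$ avoiding each of $\pi_1,\dots,\pi_m$. Patterns are written in one-line notation. *)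

theory Defs
  imports "HOL-Combinatorics.Permutations"
begin

text \<open>
  Permutations of \<open>[n] = {1..n}\<close> are functions \<open>\<tau>\<close> with \<open>\<tau> permutes {1..n}\<close>, so they are
  the identity outside \<open>{1..n}\<close>. A pattern is the list of its values in one-line notation;
  list positions start at 0, positions of \<open>\<tau>\<close> at 1.
\<close>

definition contains_pattern :: "nat \<Rightarrow> (nat \<Rightarrow> nat) \<Rightarrow> nat list \<Rightarrow> bool" where
  "contains_pattern n \<tau> p \<longleftrightarrow>
     (\<exists>c :: nat \<Rightarrow> nat.
        strict_mono_on {..<length p} c \<and> c ` {..<length p} \<subseteq> {1..n} \<and>
        (\<forall>i<length p. \<forall>j<length p. \<tau> (c i) < \<tau> (c j) \<longleftrightarrow> p ! i < p ! j))"

definition avoids_pattern :: "nat \<Rightarrow> (nat \<Rightarrow> nat) \<Rightarrow> nat list \<Rightarrow> bool" where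
  "avoids_pattern n \<tau> p \<longleftrightarrow> \<not> contains_pattern n \<tau> p"

definition three_perms :: "nat \<Rightarrow> ((nat \<Rightarrow> nat) \<times> (nat \<Rightarrow> nat)) set" where
  "three_perms n = {(\<sigma>, \<sigma>'). \<sigma> permutes {1..n} \<and> \<sigma>' permutes {1..n}}"

definition three_perm_avoids :: "nat \<Rightarrow> (nat \<Rightarrow> nat) \<times> (nat \<Rightarrow> nat) \<Rightarrow> nat list \<Rightarrow> bool" where
  "three_perm_avoids n = (\<lambda>(\<sigma>, \<sigma>') p.
     avoids_pattern n \<sigma> p \<and> avoids_pattern n \<sigma>' p \<and> avoids_pattern n (\<sigma>' \<circ> inv \<sigma>) p)"

definition avoiding_three_perms ::
  "nat \<Rightarrow> nat list set \<Rightarrow> ((nat \<Rightarrow> nat) \<times> (nat \<Rightarrow> nat)) set" where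
  "avoiding_three_perms n P = {s \<in> three_perms n. \<forall>p\<in>P. three_perm_avoids n s p}"

end

theory Submission
  imports Defs
begin

text \<open>
  A permutation avoids 132 and 231 iff no entry is larger than an entry on its left and an entry on
  its right; then its maximum stands first or last. If \<open>\<sigma>\<close> and \<open>\<sigma>'\<close> of size \<open>n + 1\<close> both have their
  maximum last, so has \<open>\<sigma>' \<circ> \<sigma>\<inverse>\<close>, and all three restrict to size \<open>n\<close>. If only \<open>\<sigma>\<close> has its
  maximum last, then \<open>\<sigma>' \<circ> \<sigma>\<inverse>\<close> takes its maximum at \<open>\<sigma> 1\<close>, which forces \<open>\<sigma> 1 = 1\<close> and hence
  \<open>\<sigma> = id\<close>, with \<open>\<sigma>'\<close> any avoider with its maximum first. Reversing \<open>\<sigma>\<close> and \<open>\<sigma>'\<close> simultaneously does not change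
  \<open>\<sigma>' \<circ> \<sigma>\<inverse>\<close> and accounts for the remaining pairs.
\<close>

text \<open>The one-line notation falls to its minimum and then rises. As \<open>\<tau>\<close> is
  the identity outside \<open>{1..n}\<close>, \<open>valley_perms n\<close> consists of the members
  of \<open>valley_perms (Suc n)\<close> that fix \<open>Suc n\<close>: changing the size changes no
  function.\<close>

definition valley_perms :: "nat \<Rightarrow> (nat \<Rightarrow> nat) set" where
  "valley_perms n = {\<tau>. \<tau> permutes {1..n} \<and>
     (\<forall>i j k. 1 \<le> i \<longrightarrow> i < j \<longrightarrow> j < k \<longrightarrow> k \<le> n \<longrightarrow> \<tau> j < \<tau> i \<or> \<tau> j < \<tau> k)}"

definition valley_pairs :: "nat \<Rightarrow> ((nat \<Rightarrow> nat) \<times> (nat \<Rightarrow> nat)) set" where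
  "valley_pairs n = {(\<sigma>, \<sigma>'). \<sigma> \<in> valley_perms n \<and> \<sigma>' \<in> valley_perms n \<and>
     \<sigma>' \<circ> inv \<sigma> \<in> valley_perms n}"

text \<open>Composing with it on the right reads the one-line notation backwards.\<close>

definition reversal :: "nat \<Rightarrow> nat \<Rightarrow> nat" where
  "reversal n i = (if i \<in> {1..n} then n + 1 - i else i)"

section \<open>Avoidance of 132 and 231 as the valley condition\<close>

lemma valley_perms_permutes: "\<tau> \<in> valley_perms n \<Longrightarrow> \<tau> permutes {1..n}"
  by (simp add: valley_perms_def)

text \<open>Both directions of each comparison are listed because \<open>x\<close>,
  \<open>y\<close>, \<open>z\<close> may coincide.\<close>

lemma contains_pattern_length_3:
  "contains_pattern n \<tau> [x, y, z] \<longleftrightarrow>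
     (\<exists>i j k. 1 \<le> i \<and> i < j \<and> j < k \<and> k \<le> n \<and>
       (\<tau> i < \<tau> j \<longleftrightarrow> x < y) \<and> (\<tau> j < \<tau> i \<longleftrightarrow> y < x) \<and>
       (\<tau> i < \<tau> k \<longleftrightarrow> x < z) \<and> (\<tau> k < \<tau> i \<longleftrightarrow> z < x) \<and>
       (\<tau> j < \<tau> k \<longleftrightarrow> y < z) \<and> (\<tau> k < \<tau> j \<longleftrightarrow> z < y))"
  (is "?L \<longleftrightarrow> ?R")
proof
  have three: "{..<length [x, y, z]} = {0, 1, 2}"
    by auto
  assume ?L
  then obtain c where c: "strict_mono_on {..<length [x, y, z]} c"
    "c ` {..<length [x, y, z]} \<subseteq> {1..n}"
    "\<forall>i<3. \<forall>j<3. \<tau> (c i) < \<tau> (c j) \<longleftrightarrow> [x, y, z] ! i < [x, y, z] ! j"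
    unfolding contains_pattern_def by (auto simp: numeral_3_eq_3)
  have "c 0 < c 1" "c 1 < c 2"
    using c(1) unfolding three by (auto intro: strict_mono_onD)
  moreover have "1 \<le> c 0" "c 2 \<le> n"
    using c(2) unfolding three by auto
  ultimately show ?R
    using c(3) by (intro exI[of _ "c 0"] exI[of _ "c 1"] exI[of _ "c 2"])
      (simp add: numeral_3_eq_3 numeral_2_eq_2 All_less_Suc)
next
  assume ?R
  then obtain i j k where ijk: "1 \<le> i" "i < j" "j < k" "k \<le> n"
    "(\<tau> i < \<tau> j \<longleftrightarrow> x < y)" "(\<tau> j < \<tau> i \<longleftrightarrow> y < x)"
    "(\<tau> i < \<tau> k \<longleftrightarrow> x < z)" "(\<tau> k < \<tau> i \<longleftrightarrow> z < x)"
    "(\<tau> j < \<tau> k \<longleftrightarrow> y < z)" "(\<tau> k < \<tau> j \<longleftrightarrow> z < y)"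
    by blast
  then show ?L
    unfolding contains_pattern_def
    by (intro exI[of _ "\<lambda>m. [i, j, k] ! m"])
      (auto simp: strict_mono_on_def less_Suc_eq nth_Cons split: nat.splits)
qed

text \<open>If the middle entry is the largest of three, the order of the outer two decides between
  132 and 231. Injectivity turns the weak inequalities of a failed valley condition into strict
  ones.\<close>

lemma valley_perms_iff_avoids:
  assumes "\<tau> permutes {1..n}"
  shows "\<tau> \<in> valley_perms n \<longleftrightarrow> avoids_pattern n \<tau> [1, 3, 2] \<and> avoids_pattern n \<tau> [2, 3, 1]"
proof -
  have "\<tau> i = \<tau> j \<longleftrightarrow> i = j" for i j
    using permutes_inj[OF assms] by (auto dest: injD)
  then have "\<tau> j < \<tau> i \<longleftrightarrow> \<not> \<tau> i < \<tau> j" if "i < j" for i j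
    using that by (metis less_irrefl linorder_neqE_nat not_less_iff_gr_or_eq)
  then show ?thesis
    unfolding valley_perms_def avoids_pattern_def contains_pattern_length_3
    using assms by (auto dest: less_trans) (metis less_trans)+
qed

lemma avoiding_three_perms_eq_valley_pairs:
  "avoiding_three_perms n {[1, 3, 2], [2, 3, 1]} = valley_pairs n"
proof -
  have "(\<sigma>, \<sigma>') \<in> avoiding_three_perms n {[1, 3, 2], [2, 3, 1]} \<longleftrightarrow> (\<sigma>, \<sigma>') \<in> valley_pairs n"
    for \<sigma> \<sigma>'
  proof (cases "\<sigma> permutes {1..n} \<and> \<sigma>' permutes {1..n}")
    case True
    then have "\<sigma>' \<circ> inv \<sigma> permutes {1..n}"
      by (simp add: permutes_compose permutes_inv)
    with True show ?thesis
      by (auto simp: avoiding_three_perms_def three_perms_def three_perm_avoids_def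
        valley_pairs_def valley_perms_iff_avoids simp del: One_nat_def)
  next
    case False
    then show ?thesis
      by (auto simp: avoiding_three_perms_def three_perms_def valley_pairs_def
        dest: valley_perms_permutes)
  qed
  then show ?thesis
    by auto
qed

lemma finite_valley_perms: "finite (valley_perms n)"
  by (rule finite_subset[OF _ finite_permutations[of "{1..n}"]]) (auto simp: valley_perms_def)

lemma finite_valley_pairs: "finite (valley_pairs n)"
  by (rule finite_subset[of _ "valley_perms n \<times> valley_perms n"])
    (auto simp: valley_pairs_def finite_valley_perms)

lemma id_in_valley_perms: "id \<in> valley_perms n"
  by (simp add: valley_perms_def permutes_id)

section \<open>Reversal of positions\<close>

lemma reversal_permutes: "reversal n permutes {1..n}"
  by (rule bij_imp_permutes[OF bij_betwI[of _ _ _ "reversal n"]]) (auto simp: reversal_def)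

lemma reversal_reversal: "reversal n \<circ> reversal n = id"
  by (auto simp: reversal_def fun_eq_iff)

lemma comp_reversal_reversal: "f \<circ> reversal n \<circ> reversal n = f"
  by (simp add: comp_assoc reversal_reversal)

lemma inv_reversal: "inv (reversal n) = reversal n"
  using reversal_reversal by (rule inv_unique_comp) (rule reversal_reversal)

text \<open>The condition is symmetric in the two outer positions, which reversal swaps.\<close>

lemma valley_perms_comp_reversal:
  assumes "\<tau> \<in> valley_perms n"
  shows "\<tau> \<circ> reversal n \<in> valley_perms n"
proof -
  have "\<tau> (n + 1 - j) < \<tau> (n + 1 - i) \<or> \<tau> (n + 1 - j) < \<tau> (n + 1 - k)"
    if "1 \<le> i" "i < j" "j < k" "k \<le> n" for i j k
  proof -
    have "1 \<le> n + 1 - k" "n + 1 - k < n + 1 - j" "n + 1 - j < n + 1 - i" "n + 1 - i \<le> n"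
      using that by auto
    then show ?thesis
      using assms unfolding valley_perms_def by blast
  qed
  then show ?thesis
    using permutes_compose[OF reversal_permutes valley_perms_permutes[OF assms]]
    by (auto simp: valley_perms_def reversal_def)
qed

text \<open>The two reversals cancel in the quotient: \<open>reversal n\<close> to the right of
  \<open>\<sigma>'\<close> meets its own inverse, the left factor of
  \<open>inv (\<sigma> \<circ> reversal n)\<close>.\<close>

lemma valley_pairs_comp_reversal:
  assumes "(\<sigma>, \<sigma>') \<in> valley_pairs n"
  shows "(\<sigma> \<circ> reversal n, \<sigma>' \<circ> reversal n) \<in> valley_pairs n"
proof -
  have "bij \<sigma>"
    using assms by (auto simp: valley_pairs_def intro: permutes_bij valley_perms_permutes)
  then have "inv (\<sigma> \<circ> reversal n) = reversal n \<circ> inv \<sigma>"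
    using o_inv_distrib[of \<sigma> "reversal n"] permutes_bij[OF reversal_permutes]
    by (simp add: inv_reversal)
  then have "\<sigma>' \<circ> reversal n \<circ> inv (\<sigma> \<circ> reversal n) = \<sigma>' \<circ> inv \<sigma>"
    by (simp add: comp_reversal_reversal flip: comp_assoc)
  then show ?thesis
    using assms by (simp add: valley_pairs_def valley_perms_comp_reversal)
qed

section \<open>The position of the maximum\<close>

lemma valley_perms_Suc_fix:
  "\<tau> \<in> valley_perms (Suc n) \<and> \<tau> (Suc n) = Suc n \<longleftrightarrow> \<tau> \<in> valley_perms n"
proof
  assume L: "\<tau> \<in> valley_perms (Suc n) \<and> \<tau> (Suc n) = Suc n"
  then have "\<tau> permutes {1..Suc n}"
    by (blast intro: valley_perms_permutes)
  then have "\<tau> permutes {1..n}"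
    by (rule permutes_superset) (use L in \<open>auto simp: le_Suc_eq\<close>)
  then show "\<tau> \<in> valley_perms n"
    using L unfolding valley_perms_def by (blast intro: le_SucI)
next
  assume R: "\<tau> \<in> valley_perms n"
  then have p: "\<tau> permutes {1..n}"
    by (rule valley_perms_permutes)
  have fix_last: "\<tau> (Suc n) = Suc n"
    using p by (rule permutes_not_in) simp
  have le: "\<tau> j \<le> n" if "1 \<le> j" "j \<le> n" for j
    using permutes_in_image[OF p, of j] that by simp
  have "\<tau> j < \<tau> i \<or> \<tau> j < \<tau> k" if "1 \<le> i" "i < j" "j < k" "k \<le> Suc n" for i j k
  proof (cases "k = Suc n")
    \<comment> \<open>A triple ending at the new position passes because
      \<open>\<tau> k = Suc n\<close> exceeds \<open>\<tau> j\<close>.\<close>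
    case True
    then show ?thesis
      using that fix_last le[of j] by simp
  next
    case False
    then have "k \<le> n"
      using that by simp
    then show ?thesis
      using that R unfolding valley_perms_def by blast
  qed
  moreover have "\<tau> permutes {1..Suc n}"
    using p by (rule permutes_subset) simp
  ultimately show "\<tau> \<in> valley_perms (Suc n) \<and> \<tau> (Suc n) = Suc n"
    using fix_last unfolding valley_perms_def by blast
qed

text \<open>A maximum at an inner position \<open>j\<close> would violate the condition on the
  triple \<open>1 < j < Suc n\<close>.\<close>

lemma valley_perms_max_at_end:
  assumes "\<tau> \<in> valley_perms (Suc n)"
  shows "\<tau> 1 = Suc n \<or> \<tau> (Suc n) = Suc n"
proof (rule ccontr)
  assume not: "\<not> ?thesis"
  have p: "\<tau> permutes {1..Suc n}"
    using assms by (rule valley_perms_permutes)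
  then obtain j where j: "j \<in> {1..Suc n}" "\<tau> j = Suc n"
    using permutes_image[OF p] by (metis (no_types, lifting) atLeastAtMost_iff imageE le_refl
      le_add1 plus_1_eq_Suc)
  then have "1 < j" "j < Suc n"
    using not by (auto simp: le_less)
  then have "\<tau> j < \<tau> 1 \<or> \<tau> j < \<tau> (Suc n)"
    using assms unfolding valley_perms_def by blast
  then have "Suc n < \<tau> 1 \<or> Suc n < \<tau> (Suc n)"
    by (simp only: j(2))
  moreover have "\<tau> 1 \<le> Suc n" "\<tau> (Suc n) \<le> Suc n"
    using permutes_in_image[OF p, of 1] permutes_in_image[OF p, of "Suc n"] by auto
  ultimately show False
    by simp
qed

text \<open>Once the size exceeds 1, a first entry \<open>1\<close> is not the maximum, so the
  maximum stands last and is fixed; dropping it leaves the same function in a smaller size.\<close>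

lemma valley_perms_fix_1_eq_id:
  "\<tau> \<in> valley_perms n \<Longrightarrow> \<tau> 1 = 1 \<Longrightarrow> \<tau> = id"
proof (induction n)
  case 0
  then show ?case
    by (simp add: valley_perms_def)
next
  case (Suc n)
  then have "\<tau> (Suc n) = Suc n"
    using valley_perms_max_at_end[OF Suc.prems(1)] by auto
  with Suc show ?case
    using valley_perms_Suc_fix by blast
qed

text \<open>Makes the case splits by the position of the maximum disjoint; \<open>n \<ge> 1\<close>
  keeps the two ends apart.\<close>

lemma valley_perms_max_not_both_ends:
  assumes "\<tau> \<in> valley_perms (Suc n)" "n \<ge> 1" "\<tau> (Suc n) = Suc n"
  shows "\<tau> 1 \<noteq> Suc n"
proof
  assume "\<tau> 1 = Suc n"
  then have "\<tau> 1 = \<tau> (Suc n)"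
    using assms(3) by simp
  then have "1 = Suc n"
    by (rule injD[OF permutes_inj[OF valley_perms_permutes[OF assms(1)]]])
  then show False
    using assms(2) by simp
qed

section \<open>Counting valley permutations\<close>

lemma valley_perms_max_first_eq_image:
  "{\<tau> \<in> valley_perms (Suc n). \<tau> 1 = Suc n} = (\<lambda>\<tau>. \<tau> \<circ> reversal (Suc n)) ` valley_perms n"
proof (intro equalityI subsetI)
  fix \<tau> assume "\<tau> \<in> {\<tau> \<in> valley_perms (Suc n). \<tau> 1 = Suc n}"
  \<comment> \<open>Reversal moves the maximum from position \<open>1\<close> to
    \<open>Suc n\<close>, where it is fixed, so the reversed permutation already has size
    \<open>n\<close>.\<close>
  then have "\<tau> \<circ> reversal (Suc n) \<in> valley_perms n"
    by (simp add: valley_perms_comp_reversal reversal_def flip: valley_perms_Suc_fix[of _ n])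
  then show "\<tau> \<in> (\<lambda>\<tau>. \<tau> \<circ> reversal (Suc n)) ` valley_perms n"
    by (rule rev_image_eqI) (simp add: comp_reversal_reversal)
next
  fix \<tau> assume "\<tau> \<in> (\<lambda>\<tau>. \<tau> \<circ> reversal (Suc n)) ` valley_perms n"
  then show "\<tau> \<in> {\<tau> \<in> valley_perms (Suc n). \<tau> 1 = Suc n}"
    by (auto simp: valley_perms_comp_reversal reversal_def simp flip: valley_perms_Suc_fix[of _ n])
qed

lemma inj_comp_reversal: "inj (\<lambda>\<tau>. \<tau> \<circ> reversal n)"
  by (rule inj_on_inverseI[where g = "\<lambda>\<tau>. \<tau> \<circ> reversal n"]) (simp add: comp_reversal_reversal)

lemma card_valley_perms_max_first:
  "card {\<tau> \<in> valley_perms (Suc n). \<tau> 1 = Suc n} = card (valley_perms n)"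
  unfolding valley_perms_max_first_eq_image
  by (rule card_image[OF inj_on_subset[OF inj_comp_reversal]]) simp

lemma valley_perms_1: "valley_perms 1 = {id}"
  using id_in_valley_perms[of 1] by (auto simp: valley_perms_def)

text \<open>Maximum last and maximum first each give a copy of the previous set. The index
  \<open>Suc n\<close> reflects that sizes 0 and 1 both have a single permutation, so doubling
  starts from size 1.\<close>

lemma card_valley_perms: "card (valley_perms (Suc n)) = 2 ^ n"
proof (induction n)
  case 0
  then show ?case
    using valley_perms_1 by simp
next
  case (Suc n)
  let ?A = "{\<tau> \<in> valley_perms (Suc (Suc n)). \<tau> 1 = Suc (Suc n)}"
  have "valley_perms (Suc (Suc n)) = valley_perms (Suc n) \<union> ?A"
    using valley_perms_max_at_end[of _ "Suc n"] valley_perms_Suc_fix[of _ "Suc n"] by blast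
  moreover have "valley_perms (Suc n) \<inter> ?A = {}"
    using valley_perms_max_not_both_ends[of _ "Suc n"] valley_perms_Suc_fix[of _ "Suc n"] by force
  ultimately have "card (valley_perms (Suc (Suc n))) = card (valley_perms (Suc n)) + card ?A"
    using card_Un_disjoint[of "valley_perms (Suc n)" ?A] by (simp add: finite_valley_perms)
  then show ?case
    using Suc.IH card_valley_perms_max_first[of "Suc n"] by simp
qed

section \<open>Pairs in which \<open>\<sigma>\<close> has its maximum last\<close>

lemma valley_pairs_Suc_both_fix:
  "(\<sigma>, \<sigma>') \<in> valley_pairs (Suc n) \<and> \<sigma> (Suc n) = Suc n \<and> \<sigma>' (Suc n) = Suc n \<longleftrightarrow>
     (\<sigma>, \<sigma>') \<in> valley_pairs n"
proof -
  \<comment> \<open>With the quotient fixing \<open>Suc n\<close> too,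
    \<open>valley_perms_Suc_fix\<close> carries all three permutations between the two
    sizes.\<close>
  have "(\<sigma>' \<circ> inv \<sigma>) (Suc n) = Suc n"
    if "\<sigma> \<in> valley_perms n" "\<sigma>' \<in> valley_perms n"
  proof (rule permutes_not_in)
    show "\<sigma>' \<circ> inv \<sigma> permutes {1..n}"
      using that by (intro permutes_compose permutes_inv valley_perms_permutes)
  qed simp
  then show ?thesis
    unfolding valley_pairs_def using valley_perms_Suc_fix by fastforce
qed

lemma valley_pairs_Suc_fix_first:
  assumes "n \<ge> 1"
  shows "{(\<sigma>, \<sigma>') \<in> valley_pairs (Suc n). \<sigma> (Suc n) = Suc n} =
    valley_pairs n \<union> {id} \<times> {\<tau> \<in> valley_perms (Suc n). \<tau> 1 = Suc n}"
    (is "?L = ?R")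
proof (intro equalityI subsetI)
  fix s assume "s \<in> ?L"
  then obtain \<sigma> \<sigma>' where s: "s = (\<sigma>, \<sigma>')" "(\<sigma>, \<sigma>') \<in> valley_pairs (Suc n)" "\<sigma> (Suc n) = Suc n"
    by auto
  then have V: "\<sigma> \<in> valley_perms (Suc n)" "\<sigma>' \<in> valley_perms (Suc n)"
    "\<sigma>' \<circ> inv \<sigma> \<in> valley_perms (Suc n)"
    by (auto simp: valley_pairs_def)
  show "s \<in> ?R"
  proof (cases "\<sigma>' (Suc n) = Suc n")
    case True
    then show ?thesis
      using s valley_pairs_Suc_both_fix by blast
  next
    case False
    then have 1: "\<sigma>' 1 = Suc n"
      using V valley_perms_max_at_end by blast
    have inj: "inj \<sigma>" "inj (\<sigma>' \<circ> inv \<sigma>)"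
      using V by (auto intro: permutes_inj valley_perms_permutes)
    \<comment> \<open>The quotient attains its maximum at \<open>\<sigma> 1\<close>, which must
      therefore be \<open>1\<close> or \<open>Suc n\<close>; the latter is already the value of
      \<open>\<sigma>\<close> at \<open>Suc n\<close>.\<close>
    have "(\<sigma>' \<circ> inv \<sigma>) (\<sigma> 1) = Suc n"
      using 1 inj(1) by simp
    moreover have "\<sigma> 1 \<noteq> Suc n"
      using V(1) assms s(3) by (rule valley_perms_max_not_both_ends)
    ultimately have "\<sigma> 1 = 1"
      using valley_perms_max_at_end[OF V(3)] inj(2) by (metis injD)
    then have "\<sigma> = id"
      using V(1) valley_perms_fix_1_eq_id by blast
    then show ?thesis
      using s 1 V by simp
  qed
next
  fix s assume "s \<in> ?R"
  then consider (both) \<sigma> \<sigma>' where "s = (\<sigma>, \<sigma>')" "(\<sigma>, \<sigma>') \<in> valley_pairs n"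
    | (id) \<tau> where "s = (id, \<tau>)" "\<tau> \<in> valley_perms (Suc n)"
    by (cases s) blast
  then show "s \<in> ?L"
  proof cases
    case both
    then show ?thesis
      using valley_pairs_Suc_both_fix by blast
  next
    \<comment> \<open>For \<open>\<sigma> = id\<close> the quotient is \<open>\<tau>\<close>
      itself.\<close>
    case id
    then show ?thesis
      by (simp add: valley_pairs_def id_in_valley_perms inv_id)
  qed
qed

lemma card_valley_pairs_Suc_fix_first:
  assumes "n \<ge> 1"
  shows "card {(\<sigma>, \<sigma>') \<in> valley_pairs (Suc n). \<sigma> (Suc n) = Suc n} =
    card (valley_pairs n) + 2 ^ (n - 1)"
proof -
  let ?B = "{\<tau> \<in> valley_perms (Suc n). \<tau> 1 = Suc n}"
  \<comment> \<open>The second components separate the two kinds of pairs: one kind fixes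
    \<open>Suc n\<close>, the other takes this value at \<open>1\<close>.\<close>
  have "\<sigma>' \<notin> ?B" if "(\<sigma>, \<sigma>') \<in> valley_pairs n" for \<sigma> \<sigma>'
  proof -
    have "\<sigma>' \<in> valley_perms n"
      using that by (simp add: valley_pairs_def)
    then show ?thesis
      using valley_perms_max_not_both_ends[OF _ assms] valley_perms_Suc_fix by blast
  qed
  then have "valley_pairs n \<inter> {id} \<times> ?B = {}"
    by blast
  \<comment> \<open>\<open>?B\<close> is as large as \<open>valley_perms n\<close>, and
    \<open>n = Suc (n - 1)\<close>.\<close>
  moreover have "card ?B = 2 ^ (n - 1)"
    using card_valley_perms_max_first[of n] card_valley_perms[of "n - 1"] assms by simp
  ultimately show ?thesis
    unfolding valley_pairs_Suc_fix_first[OF assms]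
    by (simp add: card_Un_disjoint finite_valley_pairs finite_valley_perms card_cartesian_product)
qed

section \<open>The recurrence\<close>

lemma card_valley_pairs_Suc:
  assumes "n \<ge> 1"
  shows "card (valley_pairs (Suc n)) = 2 * card (valley_pairs n) + 2 ^ n"
proof -
  let ?r = "reversal (Suc n)"
  \<comment> \<open>The involution \<open>?f\<close> moves the maximum of \<open>\<sigma>\<close>
    from one end to the other, so \<open>?A\<close> and its equally large image partition all
    pairs.\<close>
  let ?f = "\<lambda>(\<sigma>, \<sigma>'). (\<sigma> \<circ> ?r, \<sigma>' \<circ> ?r)"
  let ?A = "{(\<sigma>, \<sigma>') \<in> valley_pairs (Suc n). \<sigma> (Suc n) = Suc n}"
  have V: "\<sigma> \<in> valley_perms (Suc n)" if "(\<sigma>, \<sigma>') \<in> valley_pairs (Suc n)" for \<sigma> \<sigma>'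
    using that by (simp add: valley_pairs_def)
  have f: "?f (?f s) = s" for s
    by (cases s) (simp add: comp_reversal_reversal)
  have "inj_on ?f ?A"
    using f by (rule inj_on_inverseI)
  then have card: "card (?f ` ?A) = card ?A"
    by (rule card_image)
  have "?A \<union> ?f ` ?A = valley_pairs (Suc n)"
  proof (intro equalityI subsetI)
    fix s assume s: "s \<in> valley_pairs (Suc n)"
    obtain \<sigma> \<sigma>' where \<sigma>: "s = (\<sigma>, \<sigma>')"
      by (cases s)
    show "s \<in> ?A \<union> ?f ` ?A"
    proof (cases "\<sigma> (Suc n) = Suc n")
      case True
      then show ?thesis
        using s \<sigma> by simp
    next
      case False
      then have "\<sigma> 1 = Suc n"
        using s \<sigma> V valley_perms_max_at_end by blast
      then have "?f s \<in> ?A"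
        using s \<sigma> valley_pairs_comp_reversal by (simp add: reversal_def)
      then have "s \<in> ?f ` ?A"
        by (rule rev_image_eqI) (simp only: f)
      then show ?thesis ..
    qed
  qed (auto simp: valley_pairs_comp_reversal)
  moreover have "?A \<inter> ?f ` ?A = {}"
  proof -
    have "\<sigma> 1 \<noteq> Suc n" if "(\<sigma>, \<sigma>') \<in> ?A" for \<sigma> \<sigma>'
      using that V valley_perms_max_not_both_ends[OF _ assms] by blast
    moreover have "\<sigma> 1 = Suc n" if "(\<sigma>, \<sigma>') \<in> ?f ` ?A" for \<sigma> \<sigma>'
      using that by (auto simp: reversal_def)
    ultimately show ?thesis
      by fast
  qed
  moreover have "finite ?A"
    by (rule finite_subset[OF _ finite_valley_pairs[of "Suc n"]]) auto
  ultimately have "card (valley_pairs (Suc n)) = card ?A + card ?A"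
    using card_Un_disjoint[of ?A "?f ` ?A"] card by simp
  \<comment> \<open>Each half carries an extra \<open>2 ^ (n - 1)\<close>; together they give
    \<open>2 ^ n\<close>, as \<open>n \<ge> 1\<close>.\<close>
  also have "\<dots> = 2 * card (valley_pairs n) + 2 * 2 ^ (n - 1)"
    using card_valley_pairs_Suc_fix_first[OF assms] by simp
  also have "(2::nat) * 2 ^ (n - 1) = 2 ^ n"
    using assms by (simp flip: power_Suc)
  finally show ?thesis .
qed

theorem theorem3p1:
  fixes a :: "nat \<Rightarrow> nat"
  defines "a \<equiv> \<lambda>n. card (avoiding_three_perms n {[1,3,2], [2,3,1]})"
  shows "a 1 = 1 \<and> (\<forall>n\<ge>1. a (n + 1) = 2 * a n + 2 ^ n)"
proof -
  have a: "a n = card (valley_pairs n)" for n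
    by (simp only: a_def avoiding_three_perms_eq_valley_pairs)
  have "valley_pairs 1 = {(id, id)}"
    unfolding valley_pairs_def valley_perms_1 by (auto simp: inv_id)
  then show ?thesis
    by (simp add: a card_valley_pairs_Suc)
qed

end
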